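(* Let $\mu$ be a probability measure on $\mathbb N^d$ with downward closed support and finite mean vector $\mathbf m\in\mathbb R_{>0}^d$, and let $\mathbf X\sim\mu$. Suppose that $\mu\in\mathrm{WLSI}(1)$, and let $\mathbf Z\sim\pi_{\mathbf m}=\bigotimes_{i=1}^d\mathrm{Pois}(m_i)$. Then, for every $\boldsymbol\lambda\in\mathbb R^d$, $$\mathbf E\big[e^{\langle\boldsymbol\lambda,\mathbf X\rangle}\big]\;\le\;\exp\Big(\sum_{i=1}^d m_i\,(e^{\lambda_i}-1)\Big)=\mathbf E\big[e^{\langle\boldsymbol\lambda,\mathbf Z\rangle}\big].$$
   Context: $\mathbb N=\{0,1,2,\dots\}$; $\mathbf e_i$ is the $i$-th standard basis vector. A set $S\subseteq\mathbb N^d$ is downward closed if $\mathbf n\in S$ and $\mathbf 0\le\mathbf m\le\mathbf n$ (coordinatewise) imply $\mathbf m\in S$. For $\mathbf n\in\mathrm{supp}(\mu)$ let $b_i(\mathbf n)=(n_i+1)\mu(\mathbf n+\mathbf e_i)/\mu(\mathbf n)$, and for $f:\mathrm{supp}(\mu)\to\mathbb R$ let $\nabla_i^+f(\mathbf n)=f(\mathbf n+\mathbf e_i)-f(\mathbf n)$; terms with $\mathbf n+\mathbf e_i\notin\mathrm{supp}(\mu)$ have $b_i(\mathbf n)=0$ and are interpreted as $0$. Let $\mathcal E(f,f)=\mathbf E_\mu\big[\sum_{i=1}^d b_i(\nabla_i^+f)^2\big]$, $\mathcal D(\mathcal E)=\{f\in L^2(\mu):\mathcal E(f,f)<\infty\}$,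 $\mathcal A=\{f\in L^2(\mu):f>0,\ f\in\mathcal D(\mathcal E),\ \log f\in\mathcal D(\mathcal E)\}$, $\Psi(u,v)=(u+v)\log(u+v)-u\log u-v(\log u+1)$ with $\Psi(0,0)=0$, and $\mathrm{Ent}_\mu[f]=\mathbf E_\mu[f\log f]-\mathbf E_\mu[f]\log\mathbf E_\mu[f]$. We write $\mu\in\mathrm{WLSI}(1)$ if $$\mathrm{Ent}_\mu[f]\le\mathbf E_\mu\Big[\sum_{i=1}^d b_i\,\Psi(f,\nabla_i^+f)\Big]\qquad\text{for all } f\in\mathcal A .$$ *)

theory Defs
  imports "HOL-Probability.Probability" "HOL-Probability.Product_PMF"
begin

text \<open>
  Points of \<open>\<nat>\<^sup>d\<close> are elements of \<^typ>\<open>nat ^ 'd\<close>; a probability measure on \<open>\<nat>\<^sup>d\<close> is a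
  \<open>pmf\<close>, and its support is \<open>set_pmf\<close>.
\<close>

definition downward_closed :: "(nat ^ 'd) set \<Rightarrow> bool" where
  "downward_closed S \<longleftrightarrow> (\<forall>n\<in>S. \<forall>m. m \<le> n \<longrightarrow> m \<in> S)"

definition e_vec :: "'d \<Rightarrow> nat ^ 'd" where
  "e_vec i = axis i 1"

definition birth_rate :: "(nat ^ 'd) pmf \<Rightarrow> 'd \<Rightarrow> nat ^ 'd \<Rightarrow> real" where
  "birth_rate \<mu> i n = real (n $ i + 1) * pmf \<mu> (n + e_vec i) / pmf \<mu> n"

definition grad_plus :: "'d \<Rightarrow> (nat ^ 'd \<Rightarrow> real) \<Rightarrow> nat ^ 'd \<Rightarrow> real" where
  "grad_plus i f n = f (n + e_vec i) - f n"

text \<open>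
  A function on the support of \<open>\<mu>\<close> is represented by a total function whose values off the
  support are irrelevant: \<^term>\<open>birth_rate \<mu> i n\<close> vanishes if \<^term>\<open>n + e_vec i\<close> is
  outside the support, and all integrals are taken with respect to \<open>\<mu>\<close>.
  Expectations of nonnegative, possibly non-integrable quantities are \<open>ennreal\<close>-valued.
\<close>

definition dirichlet_form :: "(nat ^ 'd::finite) pmf \<Rightarrow> (nat ^ 'd \<Rightarrow> real) \<Rightarrow> ennreal" where
  "dirichlet_form \<mu> f =
     (\<integral>\<^sup>+ n. ennreal (\<Sum>i\<in>UNIV. birth_rate \<mu> i n * (grad_plus i f n)\<^sup>2) \<partial>measure_pmf \<mu>)"

definition L2 :: "'a pmf \<Rightarrow> ('a \<Rightarrow> real) set" where
  "L2 \<mu> = {f. integrable (measure_pmf \<mu>) (\<lambda>n. (f n)\<^sup>2)}"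

definition dirichlet_domain :: "(nat ^ 'd::finite) pmf \<Rightarrow> (nat ^ 'd \<Rightarrow> real) set" where
  "dirichlet_domain \<mu> = {f \<in> L2 \<mu>. dirichlet_form \<mu> f < \<infinity>}"

definition admissible :: "(nat ^ 'd::finite) pmf \<Rightarrow> (nat ^ 'd \<Rightarrow> real) set" where
  "admissible \<mu> = {f \<in> L2 \<mu>. (\<forall>n\<in>set_pmf \<mu>. 0 < f n) \<and>
     f \<in> dirichlet_domain \<mu> \<and> (\<lambda>n. ln (f n)) \<in> dirichlet_domain \<mu>}"

text \<open>The convention \<open>\<Psi>(0,0) = 0\<close> holds by \<open>0 * x = 0\<close>.\<close>

definition Psi :: "real \<Rightarrow> real \<Rightarrow> real" where
  "Psi u v = (u + v) * ln (u + v) - u * ln u - v * (ln u + 1)"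

text \<open>For a positive \<open>f\<close> in \<open>L\<^sup>2\<close> both integrands are integrable, since
  \<open>-1 \<le> x * ln x \<le> x\<^sup>2\<close> for \<open>x > 0\<close>.\<close>

definition Ent :: "'a pmf \<Rightarrow> ('a \<Rightarrow> real) \<Rightarrow> real" where
  "Ent \<mu> f = measure_pmf.expectation \<mu> (\<lambda>n. f n * ln (f n))
     - measure_pmf.expectation \<mu> f * ln (measure_pmf.expectation \<mu> f)"

text \<open>
  The use of \<open>ennreal\<close> loses nothing: the entropy is nonnegative by Jensen's inequality, and
  \<open>Psi u v \<ge> 0\<close> whenever \<open>u > 0\<close> and \<open>u + v > 0\<close>, by convexity of \<open>x * ln x\<close>.
\<close>

definition WLSI1 :: "(nat ^ 'd::finite) pmf \<Rightarrow> bool" where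
  "WLSI1 \<mu> \<longleftrightarrow> (\<forall>f\<in>admissible \<mu>.
     ennreal (Ent \<mu> f) \<le>
       (\<integral>\<^sup>+ n. ennreal (\<Sum>i\<in>UNIV. birth_rate \<mu> i n * Psi (f n) (grad_plus i f n)) \<partial>measure_pmf \<mu>))"

definition poisson_product :: "real ^ 'd \<Rightarrow> (nat ^ 'd::finite) pmf" where
  "poisson_product m = map_pmf vec_lambda (Pi_pmf UNIV 0 (\<lambda>i. poisson_pmf (m $ i)))"

end

theory Submission imports Defs begin

text \<open>
  This is a Herbst argument. Let \<open>G(r)\<close> be the expectation of \<open>f\<^sub>r(n) = \<Prod>\<^sub>i (1 + r c\<^sub>i)^n\<^sub>i\<close> with
  \<open>c\<^sub>i = exp \<lambda>\<^sub>i - 1\<close>. The logarithmic Sobolev inequality for \<open>f\<^sub>r\<close> collapses to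
  \<open>r G'(r) \<le> G(r) ln G(r)\<close>, so that \<open>ln G(r) / r\<close> is nonincreasing, with limit \<open>\<Sum>\<^sub>i c\<^sub>i m\<^sub>i\<close> at \<open>0\<close>.
  Only first moments are assumed, so \<open>f\<^sub>r\<close> need not be admissible. With every \<open>n\<^sub>i\<close> replaced by
  \<open>min n\<^sub>i N\<close> it is bounded above and away from \<open>0\<close>, hence admissible, and the same differential
  inequality still holds; Fatou's lemma then removes the truncation.
\<close>

section \<open>Truncated points and exponential tilts\<close>

definition truncate :: "nat \<Rightarrow> nat ^ 'd \<Rightarrow> nat ^ 'd" where
  "truncate N n = (\<chi> i. min (n $ i) N)"

definition tilt :: "real ^ 'd \<Rightarrow> nat ^ 'd \<Rightarrow> real" where
  "tilt t n = exp (t \<bullet> (\<chi> i. real (n $ i)))"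

lemma truncate_nth [simp]: "truncate N n $ i = min (n $ i) N"
  by (simp add: truncate_def)

lemma tilt_eq_exp_sum: "tilt t n = exp (\<Sum>i\<in>UNIV. t $ i * real (n $ i))"
  by (simp add: tilt_def inner_vec_def)

lemma tilt_pos [simp]: "0 < tilt t n"
  by (simp add: tilt_def)

lemma tilt_nonneg [simp]: "0 \<le> tilt t n"
  by (simp add: tilt_def)

lemma e_vec_nth: "e_vec i $ j = (if j = i then 1 else 0)"
  by (simp add: e_vec_def axis_def)

lemma tilt_add_e_vec: "tilt t (n + e_vec i) = tilt t n * exp (t $ i)"
proof -
  have "(\<Sum>j\<in>UNIV. t $ j * real ((n + e_vec i) $ j))
      = (\<Sum>j\<in>UNIV. t $ j * real (n $ j)) + (\<Sum>j\<in>UNIV. if j = i then t $ j else 0)"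
    by (subst sum.distrib [symmetric], intro sum.cong) (auto simp: e_vec_nth algebra_simps)
  then show ?thesis
    by (simp add: tilt_eq_exp_sum exp_add)
qed

text \<open>A birth in a coordinate that has reached \<open>N\<close> is invisible after truncation,
  so gradients of truncated functions vanish there.\<close>

lemma truncate_add_e_vec:
  "truncate N (n + e_vec i) = (if n $ i < N then truncate N n + e_vec i else truncate N n)"
  by (auto simp: vec_eq_iff e_vec_nth)

lemma abs_tilt_exponent_le:
  "\<bar>\<Sum>i\<in>UNIV. t $ i * real (truncate N n $ i)\<bar> \<le> (\<Sum>i\<in>UNIV. \<bar>t $ i\<bar> * real N)"
  by (rule order.trans [OF sum_abs sum_mono]) (simp add: abs_mult mult_left_mono)

lemma tilt_truncate_le: "tilt t (truncate N n) \<le> exp (\<Sum>i\<in>UNIV. \<bar>t $ i\<bar> * real N)"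
  using abs_tilt_exponent_le [of t N n] by (simp add: tilt_eq_exp_sum)

lemma birth_rate_nonneg [simp]: "0 \<le> birth_rate \<mu> i n"
  by (simp add: birth_rate_def)

section \<open>Shift formula for birth rates and finite Dirichlet energy\<close>

text \<open>Multiplying by \<open>pmf \<mu> n\<close> turns the birth rate into
  \<open>(n $ i + 1) * pmf \<mu> (n + e_vec i)\<close>, so both sides are one sum under the
  substitution of \<open>n - e_vec i\<close> for \<open>n\<close>.\<close>

lemma nn_integral_birth_rate:
  fixes \<mu> :: "(nat ^ 'd::finite) pmf"
  assumes dc: "downward_closed (set_pmf \<mu>)" and g: "\<And>n. 0 \<le> g n"
  shows "(\<integral>\<^sup>+ n. ennreal (birth_rate \<mu> i n * g n) \<partial>measure_pmf \<mu>)
       = (\<integral>\<^sup>+ n. ennreal (real (n $ i) * g (n - e_vec i)) \<partial>measure_pmf \<mu>)"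
proof -
  let ?h = "\<lambda>n. ennreal (pmf \<mu> n * (real (n $ i) * g (n - e_vec i)))"
  \<comment> \<open>Where \<open>pmf \<mu> n = 0\<close> the quotient in \<open>birth_rate\<close>
    is \<open>0\<close> by default; downward closure makes the shifted weight vanish too, so the
    cancellation holds at every \<open>n\<close>.\<close>
  have supp: "pmf \<mu> (n + e_vec i) = 0" if "pmf \<mu> n = 0" for n
  proof (rule ccontr)
    assume "pmf \<mu> (n + e_vec i) \<noteq> 0"
    then have "n + e_vec i \<in> set_pmf \<mu>" by (simp add: set_pmf_iff)
    moreover have "n \<le> n + e_vec i" by (simp add: less_eq_vec_def)
    ultimately have "n \<in> set_pmf \<mu>" using dc unfolding downward_closed_def by blast
    with that show False by (simp add: set_pmf_iff)
  qed
  have bij: "bij_betw (\<lambda>n. n + e_vec i) UNIV {n :: nat ^ 'd. n $ i \<noteq> 0}"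
  proof (rule bij_betwI [where g = "\<lambda>n. n - e_vec i"])
    show "n - e_vec i + e_vec i = n" if "n \<in> {n. n $ i \<noteq> 0}" for n :: "nat ^ 'd"
      using that by (auto simp: vec_eq_iff e_vec_nth)
  qed (auto simp: vec_eq_iff e_vec_nth)
  have "(\<integral>\<^sup>+ n. ennreal (birth_rate \<mu> i n * g n) \<partial>measure_pmf \<mu>)
      = (\<integral>\<^sup>+ n. ?h (n + e_vec i) \<partial>count_space UNIV)"
    unfolding nn_integral_measure_pmf
  proof (rule nn_integral_cong)
    fix n :: "nat ^ 'd"
    have "n + e_vec i - e_vec i = n" by (simp add: vec_eq_iff)
    moreover have "pmf \<mu> n * (birth_rate \<mu> i n * g n)
        = pmf \<mu> (n + e_vec i) * (real ((n + e_vec i) $ i) * g n)"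
      using supp [of n] by (simp add: birth_rate_def e_vec_nth)
    ultimately show "ennreal (pmf \<mu> n) * ennreal (birth_rate \<mu> i n * g n) = ?h (n + e_vec i)"
      by (simp only: ennreal_mult' [OF pmf_nonneg, symmetric])
  qed
  also have "\<dots> = (\<integral>\<^sup>+ n. ?h n \<partial>count_space {n. n $ i \<noteq> 0})"
    by (rule nn_integral_bij_count_space [OF bij])
  \<comment> \<open>Points with \<open>n $ i = 0\<close> carry the factor \<open>0\<close>, so the
    cut-off subtraction in \<open>n - e_vec i\<close> does no harm there.\<close>
  also have "\<dots> = (\<integral>\<^sup>+ n. ?h n \<partial>count_space UNIV)"
    by (rule nn_integral_count_space_eq) auto
  also have "\<dots> = (\<integral>\<^sup>+ n. ennreal (real (n $ i) * g (n - e_vec i)) \<partial>measure_pmf \<mu>)"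
    unfolding nn_integral_measure_pmf by (simp add: ennreal_mult')
  finally show ?thesis .
qed

text \<open>The gradient is at most \<open>2 * B\<close> in absolute value, and the shift formula
  with constant \<open>g\<close> equates the mean of the birth rate with that of
  \<open>n $ i\<close>, which is finite.\<close>

lemma bounded_in_dirichlet_domain:
  fixes \<mu> :: "(nat ^ 'd::finite) pmf"
  assumes dc: "downward_closed (set_pmf \<mu>)"
    and int: "\<And>i. integrable (measure_pmf \<mu>) (\<lambda>n. real (n $ i))"
    and B: "\<And>n. \<bar>f n\<bar> \<le> B"
  shows "f \<in> dirichlet_domain \<mu>"
proof -
  have B0: "0 \<le> B" using B [of undefined] by linarith
  have "integrable (measure_pmf \<mu>) (\<lambda>n. (f n)\<^sup>2)"
    by (rule measure_pmf.integrable_const_bound [where B = "B\<^sup>2"])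
      (auto intro!: AE_pmfI abs_le_square_iff [THEN iffD1] simp: B0 B)
  moreover have "dirichlet_form \<mu> f < \<infinity>"
  proof -
    have "dirichlet_form \<mu> f
        \<le> (\<integral>\<^sup>+ n. ennreal (\<Sum>i\<in>UNIV. birth_rate \<mu> i n * (2 * B)\<^sup>2) \<partial>measure_pmf \<mu>)"
      unfolding dirichlet_form_def
    proof (intro nn_integral_mono ennreal_leI sum_mono mult_left_mono)
      fix n :: "nat ^ 'd" and i
      have "\<bar>grad_plus i f n\<bar> \<le> \<bar>2 * B\<bar>"
        using B [of n] B [of "n + e_vec i"] unfolding grad_plus_def by linarith
      then show "(grad_plus i f n)\<^sup>2 \<le> (2 * B)\<^sup>2" by (rule abs_le_square_iff [THEN iffD1])
    qed simp
    also have "\<dots> = (\<Sum>i\<in>UNIV. \<integral>\<^sup>+ n. ennreal (birth_rate \<mu> i n * (2 * B)\<^sup>2) \<partial>measure_pmf \<mu>)"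
      by (simp add: sum_ennreal [symmetric] nn_integral_sum del: sum_ennreal)
    also have "\<dots> = (\<Sum>i\<in>UNIV. \<integral>\<^sup>+ n. ennreal (real (n $ i) * (2 * B)\<^sup>2) \<partial>measure_pmf \<mu>)"
      by (subst nn_integral_birth_rate [OF dc]) auto
    also have "\<dots> = (\<Sum>i\<in>UNIV. ennreal (measure_pmf.expectation \<mu> (\<lambda>n. real (n $ i) * (2 * B)\<^sup>2)))"
      by (intro sum.cong refl nn_integral_eq_integral integrable_mult_left int) auto
    also have "\<dots> < \<infinity>" by simp
    finally show ?thesis .
  qed
  ultimately show ?thesis by (simp add: dirichlet_domain_def L2_def)
qed

lemma finite_range_truncate: "finite (range (truncate N :: nat ^ 'd::finite \<Rightarrow> nat ^ 'd))"
proof -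
  have "range (truncate N :: nat ^ 'd \<Rightarrow> nat ^ 'd) \<subseteq> vec_lambda ` (PiE UNIV (\<lambda>_. {..N}))"
    by (rule image_subsetI) (rule image_eqI [where x = "\<lambda>i. min (_ $ i) N"], auto simp: truncate_def)
  then show ?thesis
    by (rule finite_subset) (intro finite_imageI finite_PiE, auto)
qed

text \<open>The truncated point takes finitely many values, so its law has finite support.\<close>

lemma integrable_truncated:
  fixes \<mu> :: "(nat ^ 'd::finite) pmf" and h :: "nat ^ 'd \<Rightarrow> real"
  shows "integrable (measure_pmf \<mu>) (\<lambda>n. h (truncate N n))"
proof -
  have "finite (set_pmf (map_pmf (truncate N) \<mu>))"
    by (rule finite_subset [OF _ finite_range_truncate [of N]]) auto
  then have "integrable (measure_pmf (map_pmf (truncate N) \<mu>)) h"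
    by (rule integrable_measure_pmf_finite)
  then show ?thesis by simp
qed

section \<open>The logarithmic Sobolev inequality for truncated tilts\<close>

text \<open>All \<open>ln u\<close> terms cancel when the jump is multiplicative. Hence the right
  side of the logarithmic Sobolev inequality becomes linear in a tilt.\<close>

lemma Psi_multiplicative:
  assumes "0 < u"
  shows "Psi u (u * exp s - u) = u * (s * exp s - exp s + 1)"
  using assms by (simp add: Psi_def ln_mult algebra_simps)

text \<open>After division by \<open>exp s\<close> this is
  \<open>1 - s \<le> exp (- s)\<close>.\<close>

lemma exp_entropy_nonneg: "0 \<le> s * exp s - exp s + (1 :: real)"
proof -
  have "exp s * (1 - s) \<le> exp s * exp (- s)"
    using exp_ge_add_one_self [of "- s"] by (intro mult_left_mono) auto
  then show ?thesis by (simp add: exp_minus algebra_simps)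
qed

text \<open>With \<open>K = truncate N n\<close>, \<open>ln f\<close> is linear in \<open>K\<close>,
  so the mean of \<open>f * ln f\<close> is a combination of the means of \<open>K $ i * f\<close>.
  The shift formula bounds the energy by the same means, and subtraction leaves the coefficients
  \<open>1 - exp (- t $ i)\<close>.\<close>

lemma WLSI1_tilt_truncate:
  fixes \<mu> :: "(nat ^ 'd::finite) pmf" and t :: "real ^ 'd" and N :: nat
  assumes dc: "downward_closed (set_pmf \<mu>)"
    and int: "\<And>i. integrable (measure_pmf \<mu>) (\<lambda>n. real (n $ i))"
    and wlsi: "WLSI1 \<mu>"
  defines "f \<equiv> \<lambda>n. tilt t (truncate N n)"
  shows "(\<Sum>i\<in>UNIV. (1 - exp (- t $ i)) *
             measure_pmf.expectation \<mu> (\<lambda>n. real (truncate N n $ i) * f n))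
         \<le> measure_pmf.expectation \<mu> f * ln (measure_pmf.expectation \<mu> f)"
proof -
  define EK where "EK i = measure_pmf.expectation \<mu> (\<lambda>n. real (truncate N n $ i) * f n)" for i
  \<comment> \<open>The value of \<open>Psi\<close> per unit of \<open>f\<close> at a jump by the
    factor \<open>exp (t $ i)\<close>.\<close>
  define ent where "ent i = t $ i * exp (t $ i) - exp (t $ i) + 1" for i
  have fpos: "0 < f n" for n by (simp add: f_def)
  have f_add: "f (n + e_vec i) = f n * (if n $ i < N then exp (t $ i) else 1)" for n i
    by (simp add: f_def truncate_add_e_vec tilt_add_e_vec)
  have int_Kf: "integrable (measure_pmf \<mu>) (\<lambda>n. real (truncate N n $ i) * f n)" for i
    unfolding f_def by (rule integrable_truncated)
  have EK_nonneg: "0 \<le> EK i" for i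
    unfolding EK_def by (intro Bochner_Integration.integral_nonneg) (use fpos in \<open>auto simp: less_imp_le\<close>)
  have ln_f: "ln (f n) = (\<Sum>i\<in>UNIV. t $ i * real (truncate N n $ i))" for n
    by (simp add: f_def tilt_eq_exp_sum)
  have f_dom: "f \<in> dirichlet_domain \<mu>"
    using tilt_truncate_le [of t N] fpos
    by (intro bounded_in_dirichlet_domain [OF dc int]) (auto simp: f_def abs_of_pos)
  moreover have "(\<lambda>n. ln (f n)) \<in> dirichlet_domain \<mu>"
    using abs_tilt_exponent_le [of t N] by (intro bounded_in_dirichlet_domain [OF dc int]) (simp only: ln_f)
  ultimately have adm: "f \<in> admissible \<mu>"
    using fpos by (simp add: admissible_def dirichlet_domain_def)
  have "ennreal (Ent \<mu> f)
      \<le> (\<integral>\<^sup>+ n. ennreal (\<Sum>i\<in>UNIV. birth_rate \<mu> i n * Psi (f n) (grad_plus i f n)) \<partial>measure_pmf \<mu>)"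
    using wlsi adm unfolding WLSI1_def by blast
  also have "\<dots> = (\<integral>\<^sup>+ n. ennreal (\<Sum>i\<in>UNIV. birth_rate \<mu> i n *
                   (if n $ i < N then f n * ent i else 0)) \<partial>measure_pmf \<mu>)"
  proof -
    \<comment> \<open>In a saturated coordinate the gradient is \<open>0\<close>, and
      \<open>Psi u 0 = 0\<close>.\<close>
    have "Psi (f n) (grad_plus i f n) = (if n $ i < N then f n * ent i else 0)" for n i
      using fpos [of n] Psi_multiplicative [of "f n" "t $ i"]
      by (simp add: grad_plus_def f_add ent_def Psi_def)
    then show ?thesis by simp
  qed
  also have "\<dots> = (\<Sum>i\<in>UNIV. \<integral>\<^sup>+ n. ennreal (birth_rate \<mu> i n *
                   (if n $ i < N then f n * ent i else 0)) \<partial>measure_pmf \<mu>)"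
    using fpos exp_entropy_nonneg
    by (subst nn_integral_sum [symmetric])
      (auto intro!: nn_integral_cong sum_ennreal [symmetric] mult_nonneg_nonneg simp: less_imp_le ent_def)
  also have "\<dots> = (\<Sum>i\<in>UNIV. \<integral>\<^sup>+ n. ennreal (real (n $ i) *
                   (if (n - e_vec i) $ i < N then f (n - e_vec i) * ent i else 0)) \<partial>measure_pmf \<mu>)"
    using fpos exp_entropy_nonneg
    by (intro sum.cong refl nn_integral_birth_rate [OF dc]) (auto intro!: mult_nonneg_nonneg simp: less_imp_le ent_def)
  also have "\<dots> \<le> (\<Sum>i\<in>UNIV. \<integral>\<^sup>+ n. ennreal (exp (- t $ i) * ent i * (real (truncate N n $ i) * f n)) \<partial>measure_pmf \<mu>)"
  proof (intro sum_mono nn_integral_mono ennreal_leI)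
    fix i :: 'd and n :: "nat ^ 'd"
    have "0 \<le> ent i" unfolding ent_def by (rule exp_entropy_nonneg)
    then have nonneg: "0 \<le> exp (- t $ i) * ent i * (real (truncate N n $ i) * f n)"
      using fpos [of n] by simp
    show "real (n $ i) * (if (n - e_vec i) $ i < N then f (n - e_vec i) * ent i else 0)
        \<le> exp (- t $ i) * ent i * (real (truncate N n $ i) * f n)"
    \<comment> \<open>For \<open>N < n $ i\<close> the gradient at \<open>n - e_vec i\<close> vanishes, and the right side is only increased.\<close>
    proof (cases "0 < n $ i \<and> n $ i \<le> N")
      case True
      then have "n - e_vec i + e_vec i = n" by (auto simp: vec_eq_iff e_vec_nth)
      moreover have lt: "(n - e_vec i) $ i < N" using True by (simp add: e_vec_nth) linarith
      \<comment> \<open>The factor \<open>exp (- t $ i)\<close> is the price of moving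
        \<open>f\<close> from \<open>n - e_vec i\<close> back to \<open>n\<close>.\<close>
      ultimately have "f n = f (n - e_vec i) * exp (t $ i)"
        using f_add [of "n - e_vec i" i] by simp
      then show ?thesis using True lt by (simp add: exp_minus field_simps)
    next
      case False
      then have eq: "real (n $ i) * (if (n - e_vec i) $ i < N then f (n - e_vec i) * ent i else 0) = 0"
        by (auto simp: e_vec_nth)
      show ?thesis unfolding eq by (rule nonneg)
    qed
  qed
  also have "\<dots> = (\<Sum>i\<in>UNIV. ennreal (exp (- t $ i) * ent i * EK i))"
  proof (rule sum.cong [OF refl])
    fix i
    have "0 \<le> ent i" unfolding ent_def by (rule exp_entropy_nonneg)
    then have "(\<integral>\<^sup>+ n. ennreal (exp (- t $ i) * ent i * (real (truncate N n $ i) * f n)) \<partial>measure_pmf \<mu>)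
        = ennreal (measure_pmf.expectation \<mu> (\<lambda>n. exp (- t $ i) * ent i * (real (truncate N n $ i) * f n)))"
      using fpos by (intro nn_integral_eq_integral integrable_mult_right int_Kf AE_pmfI) (auto simp: less_imp_le)
    then show "(\<integral>\<^sup>+ n. ennreal (exp (- t $ i) * ent i * (real (truncate N n $ i) * f n)) \<partial>measure_pmf \<mu>)
        = ennreal (exp (- t $ i) * ent i * EK i)"
      by (simp add: EK_def)
  qed
  also have "\<dots> = ennreal (\<Sum>i\<in>UNIV. exp (- t $ i) * ent i * EK i)"
    using EK_nonneg exp_entropy_nonneg by (intro sum_ennreal) (simp add: ent_def)
  finally have "Ent \<mu> f \<le> (\<Sum>i\<in>UNIV. exp (- t $ i) * ent i * EK i)"
    by (subst (asm) ennreal_le_iff)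
      (use EK_nonneg exp_entropy_nonneg in \<open>auto intro!: sum_nonneg simp: ent_def\<close>)
  moreover have "measure_pmf.expectation \<mu> (\<lambda>n. f n * ln (f n)) = (\<Sum>i\<in>UNIV. t $ i * EK i)"
  proof -
    have "measure_pmf.expectation \<mu> (\<lambda>n. f n * ln (f n))
        = measure_pmf.expectation \<mu> (\<lambda>n. \<Sum>i\<in>UNIV. t $ i * (real (truncate N n $ i) * f n))"
      by (simp add: ln_f sum_distrib_left mult_ac)
    also have "\<dots> = (\<Sum>i\<in>UNIV. t $ i * EK i)"
      by (subst Bochner_Integration.integral_sum) (auto simp: EK_def int_Kf [simplified])
    finally show ?thesis .
  qed
  \<comment> \<open>The summand \<open>t $ i\<close> cancels against the mean of
    \<open>f * ln f\<close> in the entropy.\<close>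
  moreover have "exp (- t $ i) * ent i = t $ i - (1 - exp (- t $ i))" for i
    by (simp add: ent_def exp_minus field_simps)
  ultimately have "(\<Sum>i\<in>UNIV. (1 - exp (- t $ i)) * EK i)
      \<le> measure_pmf.expectation \<mu> f * ln (measure_pmf.expectation \<mu> f)"
    by (simp add: Ent_def left_diff_distrib sum_subtractf)
  then show ?thesis by (simp only: EK_def)
qed

section \<open>The Herbst argument along a path of tilts\<close>

text \<open>The derivative of \<open>ln (G r) / r\<close> is
  \<open>(r * G' r / G r - ln (G r)) / r\<^sup>2\<close>, which \<open>ineq\<close> makes
  nonpositive. The value at \<open>1\<close> is therefore at most the limit at
  \<open>0\<close>.\<close>

lemma ln_le_deriv_at_0:
  fixes G G' :: "real \<Rightarrow> real"
  assumes deriv: "\<And>r. 0 \<le> r \<Longrightarrow> r \<le> 1 \<Longrightarrow> (G has_real_derivative G' r) (at r)"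
    and pos: "\<And>r. 0 \<le> r \<Longrightarrow> r \<le> 1 \<Longrightarrow> 0 < G r"
    and G0: "G 0 = 1"
    and ineq: "\<And>r. 0 < r \<Longrightarrow> r \<le> 1 \<Longrightarrow> r * G' r \<le> G r * ln (G r)"
  shows "ln (G 1) \<le> G' 0"
proof -
  have deriv_ln: "((\<lambda>x. ln (G x)) has_real_derivative G' r / G r) (at r)"
    if "0 \<le> r" "r \<le> 1" for r
    using that by (auto intro!: derivative_eq_intros deriv pos)
  have "ln (G 1) / 1 \<le> ln (G r) / r" if r: "0 < r" "r \<le> 1" for r
  proof (rule DERIV_nonpos_imp_nonincreasing [of r 1 "\<lambda>x. ln (G x) / x"])
    show "r \<le> 1" by (rule r)
    fix x assume x: "r \<le> x" "x \<le> 1"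
    with r have x0: "0 < x" by linarith
    have "((\<lambda>x. ln (G x) / x) has_real_derivative (G' x / G x * x - ln (G x) * 1) / (x * x)) (at x)"
      using x0 x by (intro DERIV_divide deriv_ln DERIV_ident) auto
    moreover have "(G' x / G x * x - ln (G x) * 1) / (x * x) \<le> 0"
      using ineq [of x] x0 x pos [of x] by (intro divide_nonpos_pos) (auto simp: field_simps)
    ultimately show "\<exists>y. ((\<lambda>x. ln (G x) / x) has_real_derivative y) (at x) \<and> y \<le> 0" by blast
  qed
  then have "eventually (\<lambda>r. ln (G 1) \<le> ln (G r) / r) (at_right 0)"
    by (auto simp: eventually_at_right_field intro!: exI [of _ 1])
  \<comment> \<open>As \<open>ln (G 0) = 0\<close>, this is the difference quotient of
    \<open>ln (G r)\<close> at \<open>0\<close>.\<close>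
  moreover have "((\<lambda>r. ln (G r) / r) \<longlongrightarrow> G' 0) (at_right 0)"
    using deriv_ln [of 0] by (auto simp: DERIV_def G0 intro: tendsto_mono [OF at_le])
  ultimately show ?thesis
    by (intro tendsto_lowerbound) auto
qed

text \<open>As a finite sum, the expectation can be differentiated in a parameter term by
  term.\<close>

lemma expectation_truncated:
  fixes \<mu> :: "(nat ^ 'd::finite) pmf" and h :: "nat ^ 'd \<Rightarrow> real"
  shows "measure_pmf.expectation \<mu> (\<lambda>n. h (truncate N n))
       = (\<Sum>k\<in>range (truncate N). h k * pmf (map_pmf (truncate N) \<mu>) k)"
proof -
  have "measure_pmf.expectation \<mu> (\<lambda>n. h (truncate N n))
      = measure_pmf.expectation (map_pmf (truncate N) \<mu>) h" by simp
  also have "\<dots> = (\<Sum>k\<in>range (truncate N). h k * pmf (map_pmf (truncate N) \<mu>) k)"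
    by (rule integral_measure_pmf_real) (auto simp: finite_range_truncate)
  finally show ?thesis .
qed

text \<open>The tilts are joined to the constant \<open>1\<close> by a path on which the inequality
  for truncated tilts reads \<open>r * G' r \<le> G r * ln (G r)\<close>.\<close>

lemma tilt_truncate_expectation_le:
  fixes \<mu> :: "(nat ^ 'd::finite) pmf"
  assumes dc: "downward_closed (set_pmf \<mu>)"
    and int: "\<And>i. integrable (measure_pmf \<mu>) (\<lambda>n. real (n $ i))"
    and wlsi: "WLSI1 \<mu>"
  shows "measure_pmf.expectation \<mu> (\<lambda>n. tilt t (truncate N n))
       \<le> exp (\<Sum>i\<in>UNIV. (exp (t $ i) - 1) * measure_pmf.expectation \<mu> (\<lambda>n. real (truncate N n $ i)))"
proof -
  define c where "c i = exp (t $ i) - 1" for i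
  \<comment> \<open>Chosen so that \<open>exp (path r $ i) = 1 + r * c i\<close> is affine in
    \<open>r\<close>; the path runs from \<open>0\<close> to \<open>t\<close>.\<close>
  define path where "path r = (\<chi> i. ln (1 + r * c i))" for r
  \<comment> \<open>The logarithmic derivative in \<open>r\<close> of
    \<open>tilt (path r) k\<close>.\<close>
  define S where "S r k = (\<Sum>i\<in>UNIV. c i / (1 + r * c i) * real (k $ i))" for r and k :: "nat ^ 'd"
  define G where "G r = measure_pmf.expectation \<mu> (\<lambda>n. tilt (path r) (truncate N n))" for r
  define G' where "G' r = measure_pmf.expectation \<mu>
    (\<lambda>n. S r (truncate N n) * tilt (path r) (truncate N n))" for r
  have arg_pos: "0 < 1 + r * c i" if "0 \<le> r" "r \<le> 1" for r i
  proof -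
    \<comment> \<open>A convex combination of \<open>1\<close> and
      \<open>exp (t $ i)\<close>.\<close>
    have "1 + r * c i = (1 - r) + r * exp (t $ i)" by (simp add: c_def algebra_simps)
    moreover have "0 < r * exp (t $ i) \<or> 0 < 1 - r" using that by (cases "r = 0") auto
    ultimately show ?thesis using that by (smt (verit) mult_nonneg_nonneg exp_ge_zero)
  qed
  have deriv_tilt: "((\<lambda>r. tilt (path r) k) has_real_derivative S r k * tilt (path r) k) (at r)"
    if "0 \<le> r" "r \<le> 1" for r k
    unfolding tilt_eq_exp_sum path_def S_def
    using arg_pos [OF that] by (auto intro!: derivative_eq_intros simp: less_imp_neq [symmetric])
  have "ln (G 1) \<le> G' 0"
  proof (rule ln_le_deriv_at_0)
    fix r :: real assume r: "0 \<le> r" "r \<le> 1"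
    show "(G has_real_derivative G' r) (at r)"
      unfolding G_def G'_def expectation_truncated
        expectation_truncated [of \<mu> "\<lambda>k. S r k * tilt (path r) k"]
      by (intro DERIV_sum DERIV_cmult_right deriv_tilt r)
    show "0 < G r"
      unfolding G_def by (intro measure_pmf.expectation_greater integrable_truncated) simp
  next
    show "G 0 = 1" by (simp add: G_def path_def tilt_eq_exp_sum)
  next
    fix r :: real assume r: "0 < r" "r \<le> 1"
    have "r * G' r = measure_pmf.expectation \<mu> (\<lambda>n. \<Sum>i\<in>UNIV. (1 - exp (- path r $ i)) *
        (real (truncate N n $ i) * tilt (path r) (truncate N n)))"
    proof -
      \<comment> \<open>This identity matches \<open>r * S r\<close> with the coefficients in the
        inequality for truncated tilts.\<close>
      have "1 - exp (- path r $ i) = r * (c i / (1 + r * c i))" for i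
        using arg_pos [of r i] r by (simp add: path_def exp_minus field_simps)
      then show ?thesis
        by (simp add: G'_def S_def sum_distrib_left sum_distrib_right mult_ac flip: integral_mult_right_zero)
    qed
    also have "\<dots> = (\<Sum>i\<in>UNIV. (1 - exp (- path r $ i)) * measure_pmf.expectation \<mu>
        (\<lambda>n. real (truncate N n $ i) * tilt (path r) (truncate N n)))"
      by (subst Bochner_Integration.integral_sum)
        (auto simp del: truncate_nth intro!: integrable_mult_right integrable_truncated)
    also have "\<dots> \<le> G r * ln (G r)"
      unfolding G_def by (rule WLSI1_tilt_truncate [OF dc int wlsi])
    finally show "r * G' r \<le> G r * ln (G r)" .
  qed
  moreover have "G' 0 = (\<Sum>i\<in>UNIV. c i * measure_pmf.expectation \<mu> (\<lambda>n. real (truncate N n $ i)))"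
  proof -
    have "G' 0 = measure_pmf.expectation \<mu> (\<lambda>n. \<Sum>i\<in>UNIV. c i * real (truncate N n $ i))"
      by (simp add: G'_def S_def path_def tilt_eq_exp_sum)
    also have "\<dots> = (\<Sum>i\<in>UNIV. c i * measure_pmf.expectation \<mu> (\<lambda>n. real (truncate N n $ i)))"
      by (subst Bochner_Integration.integral_sum)
        (auto simp del: truncate_nth intro!: integrable_mult_right integrable_truncated)
    finally show ?thesis .
  qed
  moreover have "0 < G 1"
    unfolding G_def by (intro measure_pmf.expectation_greater integrable_truncated) simp
  moreover have "path 1 = t" by (simp add: path_def c_def vec_eq_iff)
  ultimately show ?thesis
    unfolding c_def by (simp add: G_def ln_le_cancel_iff ln_ge_iff flip: ln_le_cancel_iff)
qed

section \<open>Removing the truncation\<close>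

text \<open>The truncated tilts need not be monotone in \<open>N\<close>, since \<open>t\<close> may
  have entries of both signs. Fatou's lemma handles the left side and dominated convergence the
  means on the right.\<close>

lemma nn_integral_tilt_le:
  fixes \<mu> :: "(nat ^ 'd::finite) pmf"
  assumes dc: "downward_closed (set_pmf \<mu>)"
    and int: "\<And>i. integrable (measure_pmf \<mu>) (\<lambda>n. real (n $ i))"
    and wlsi: "WLSI1 \<mu>"
  shows "(\<integral>\<^sup>+ n. ennreal (tilt t n) \<partial>measure_pmf \<mu>)
       \<le> ennreal (exp (\<Sum>i\<in>UNIV. (exp (t $ i) - 1) * measure_pmf.expectation \<mu> (\<lambda>n. real (n $ i))))"
proof -
  define u where "u N = exp (\<Sum>i\<in>UNIV. (exp (t $ i) - 1) *
    measure_pmf.expectation \<mu> (\<lambda>n. real (truncate N n $ i)))" for N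
  have trunc_lim: "(\<lambda>N. h (truncate N n)) \<longlonglongrightarrow> h n" for h :: "nat ^ 'd \<Rightarrow> real" and n
  proof (rule tendsto_eventually)
    \<comment> \<open>Each sequence is eventually constant: the coordinate sum dominates every
      coordinate.\<close>
    have "truncate N n = n" if "(\<Sum>i\<in>UNIV. n $ i) \<le> N" for N
      using that member_le_sum [of _ UNIV "\<lambda>i. n $ i"] by (auto simp: vec_eq_iff min_def intro: order.trans)
    then show "eventually (\<lambda>N. h (truncate N n) = h n) sequentially"
      unfolding eventually_sequentially by metis
  qed
  have "(\<integral>\<^sup>+ n. ennreal (tilt t n) \<partial>measure_pmf \<mu>)
      = (\<integral>\<^sup>+ n. liminf (\<lambda>N. ennreal (tilt t (truncate N n))) \<partial>measure_pmf \<mu>)"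
    by (intro nn_integral_cong lim_imp_Liminf [symmetric] tendsto_ennrealI trunc_lim) simp
  also have "\<dots> \<le> liminf (\<lambda>N. \<integral>\<^sup>+ n. ennreal (tilt t (truncate N n)) \<partial>measure_pmf \<mu>)"
    by (rule nn_integral_liminf) simp
  also have "\<dots> = liminf (\<lambda>N. ennreal (measure_pmf.expectation \<mu> (\<lambda>n. tilt t (truncate N n))))"
    by (simp add: nn_integral_eq_integral integrable_truncated)
  also have "\<dots> \<le> liminf (\<lambda>N. ennreal (u N))"
    unfolding u_def
    by (intro Liminf_mono always_eventually allI ennreal_leI tilt_truncate_expectation_le [OF dc int wlsi])
  also have "\<dots> = ennreal (exp (\<Sum>i\<in>UNIV. (exp (t $ i) - 1) *
      measure_pmf.expectation \<mu> (\<lambda>n. real (n $ i))))"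
    unfolding u_def
  proof (intro lim_imp_Liminf tendsto_ennrealI tendsto_exp tendsto_sum tendsto_mult_left)
    fix i
    \<comment> \<open>The dominating function is \<open>n $ i\<close> itself, integrable by the
      finite mean.\<close>
    show "(\<lambda>N. measure_pmf.expectation \<mu> (\<lambda>n. real (truncate N n $ i)))
        \<longlonglongrightarrow> measure_pmf.expectation \<mu> (\<lambda>n. real (n $ i))"
      by (rule integral_dominated_convergence [OF _ _ int [of i]])
        (auto intro!: AE_pmfI trunc_lim [of "\<lambda>n. real (n $ i)", simplified])
  qed simp
  finally show ?thesis .
qed

section \<open>Poisson exponential moments and the conclusion\<close>

text \<open>Absorbing \<open>exp (s * k)\<close> into \<open>a ^ k\<close> gives the exponential
  series at \<open>a * exp s\<close>.\<close>

lemma nn_integral_poisson_exp: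
  assumes "0 < a"
  shows "(\<integral>\<^sup>+ k. ennreal (exp (s * real k)) \<partial>measure_pmf (poisson_pmf a)) = ennreal (exp (a * (exp s - 1)))"
proof -
  have "(\<lambda>k. exp (- a) * ((a * exp s) ^ k /\<^sub>R fact k)) sums (exp (- a) * exp (a * exp s))"
    by (intro sums_mult exp_converges)
  then have "(\<Sum>k. ennreal (exp (- a) * ((a * exp s) ^ k /\<^sub>R fact k))) = ennreal (exp (- a) * exp (a * exp s))"
    by (rule suminf_ennreal_eq [rotated]) (use assms in auto)
  moreover have "(\<integral>\<^sup>+ k. ennreal (exp (s * real k)) \<partial>measure_pmf (poisson_pmf a))
      = (\<Sum>k. ennreal (exp (- a) * ((a * exp s) ^ k /\<^sub>R fact k)))"
    unfolding nn_integral_measure_pmf nn_integral_count_space_nat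
    using assms
    by (intro suminf_cong)
      (simp add: ennreal_mult' [symmetric] power_mult_distrib exp_of_nat_mult [symmetric] field_simps)
  ultimately show ?thesis by (simp add: right_diff_distrib exp_diff exp_minus field_simps)
qed

text \<open>A tilt is a product over coordinates, which are independent under the product
  law.\<close>

lemma nn_integral_poisson_product_tilt:
  fixes m t :: "real ^ 'd::finite"
  assumes "\<And>i. 0 < m $ i"
  shows "(\<integral>\<^sup>+ n. ennreal (tilt t n) \<partial>measure_pmf (poisson_product m))
       = ennreal (exp (\<Sum>i\<in>UNIV. m $ i * (exp (t $ i) - 1)))"
proof -
  have "(\<integral>\<^sup>+ n. ennreal (tilt t n) \<partial>measure_pmf (poisson_product m))
      = (\<integral>\<^sup>+ y. (\<Prod>i\<in>UNIV. ennreal (exp (t $ i * real (y i))))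
          \<partial>measure_pmf (Pi_pmf UNIV 0 (\<lambda>i. poisson_pmf (m $ i))))"
    by (simp add: poisson_product_def tilt_eq_exp_sum exp_sum prod_ennreal)
  also have "\<dots> = ennreal (exp (\<Sum>i\<in>UNIV. m $ i * (exp (t $ i) - 1)))"
    by (subst nn_integral_prod_Pi_pmf) (simp_all add: nn_integral_poisson_exp assms exp_sum prod_ennreal)
  finally show ?thesis .
qed

theorem theorem5p1:
  fixes \<mu> :: "(nat ^ 'd::finite) pmf"
    and m t :: "real ^ 'd"
    and P :: "'a measure" and X :: "'a \<Rightarrow> nat ^ 'd"
    and Q :: "'b measure" and Z :: "'b \<Rightarrow> nat ^ 'd"
  assumes "downward_closed (set_pmf \<mu>)"
    and "\<And>i. integrable (measure_pmf \<mu>) (\<lambda>n. real (n $ i))"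
    and "\<And>i. measure_pmf.expectation \<mu> (\<lambda>n. real (n $ i)) = m $ i"
    and "\<And>i. 0 < m $ i"
    and "prob_space P" and "X \<in> measurable P (count_space UNIV)"
    and "distr P (count_space UNIV) X = measure_pmf \<mu>"
    and "WLSI1 \<mu>"
    and "prob_space Q" and "Z \<in> measurable Q (count_space UNIV)"
    and "distr Q (count_space UNIV) Z = measure_pmf (poisson_product m)"
  shows "(\<integral>\<^sup>+ \<omega>. ennreal (exp (t \<bullet> (\<chi> i. real (X \<omega> $ i)))) \<partial>P)
           \<le> ennreal (exp (\<Sum>i\<in>UNIV. m $ i * (exp (t $ i) - 1)))
       \<and> ennreal (exp (\<Sum>i\<in>UNIV. m $ i * (exp (t $ i) - 1)))
           = (\<integral>\<^sup>+ \<omega>. ennreal (exp (t \<bullet> (\<chi> i. real (Z \<omega> $ i)))) \<partial>Q)"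
proof
  show "(\<integral>\<^sup>+ \<omega>. ennreal (exp (t \<bullet> (\<chi> i. real (X \<omega> $ i)))) \<partial>P)
      \<le> ennreal (exp (\<Sum>i\<in>UNIV. m $ i * (exp (t $ i) - 1)))"
    using nn_integral_tilt_le [OF assms(1,2,8), of t]
      nn_integral_distr [OF assms(6), of "\<lambda>n. ennreal (tilt t n)"]
    by (simp add: assms(3,7) tilt_def mult.commute)
next
  show "ennreal (exp (\<Sum>i\<in>UNIV. m $ i * (exp (t $ i) - 1)))
      = (\<integral>\<^sup>+ \<omega>. ennreal (exp (t \<bullet> (\<chi> i. real (Z \<omega> $ i)))) \<partial>Q)"
    using nn_integral_poisson_product_tilt [OF assms(4), of t]
      nn_integral_distr [OF assms(10), of "\<lambda>n. ennreal (tilt t n)"]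
    by (simp add: assms(11) tilt_def)
qed

end
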